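(* Consider a left-invariant Lorentzian problem on $G=\mathrm{Aff}_+(\mathbb R)$ given by a matrix $A=\begin{pmatrix}a&b\\c&d\end{pmatrix}$, $|A|>0$, $a\ge0$, with sectional curvature $K>0$. Let $q_1=(x_1,y_1)\in G$, $d(q_1)=d(\mathrm{Id},q_1)$, $w=\frac{x_1+\nu(y_1-1)}{\lambda}$, $s_1=\operatorname{sgn}\gamma$. (1) If $q_1\notin J^+$, then $d(q_1)=0$. (2) If $q_1\in\partial J^+$, then $d(q_1)=0$. (3) If $q_1\in\operatorname{int}J^+\cap\{w\ne0\}$, then $d(q_1)=s_1\frac{\rho-\tau}{\Delta}$, where $$\tau=\operatorname{arcosh}\left(s_2\frac{1-y_1^2-w^2}{2y_1w}\right),\qquad \rho=\operatorname{arcosh}\left(s_2\frac{1-y_1^2+w^2}{2w}\right),\qquad s_2=\operatorname{sgn}(\lambda w).$$ In particular, $d(\operatorname{int}J^+\cap\{w\neq0\})=(0,+\infty)$. (4) If $q_1\in\operatorname{int}J^+\cap\{w=0\}$, then $d(q_1)=s_1\frac{\ln y_1}{\Delta}$. In particular, $d(\operatorname{int}J^+\cap\{w=0\})=(0,+\infty)$.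
   Context: $G=\mathrm{Aff}_+(\mathbb R)=\{(x,y)\in\mathbb R^2: y>0\}$ with product $(x_2,y_2)\cdot(x_1,y_1)=(x_2+y_2x_1,\,y_2y_1)$ and identity $\mathrm{Id}=(0,1)$; left-invariant frame $X_1=y\,\partial_x$, $X_2=y\,\partial_y$. A real matrix $A=\begin{pmatrix}a&b\\c&d\end{pmatrix}$ with $|A|=ad-bc>0$ determines the left-invariant Lorentzian form $g(u_1X_1+u_2X_2)=-v_1^2+v_2^2$, $v_1=au_1+bu_2$, $v_2=cu_1+du_2$, with time orientation in which future directed nonspacelike vectors are those with $v_1\ge|v_2|$. Standing assumption of the paper: $a\ge0$. Write $A^{-1}=\begin{pmatrix}\alpha&\beta\\ \gamma&\delta\end{pmatrix}$. The sectional curvature is $K=(c^2-a^2)/|A|^2=\gamma^2-\delta^2$. A future directed nonspacelike curve is a Lipschitz curve whose velocity is a.e. future directed nonspacelike; its Lorentzian length is $\int\sqrt{v_1^2-v_2^2}\,dt$. $J^+$ is the set of endpoints of such curves starting at $\mathrm{Id}$. The Lorentzian distance $d(q_0,q_1)$ is the supremum of lengths of such curves from $q_0$ to $q_1$, and $0$ if there are none. Boundaries and interiors are taken in $G$. For $K>0$: $\Delta=\sqrt{\gamma^2-\delta^2}$, $\lambda=\frac{\alpha\delta-\beta\gamma}{\Delta^2}$, $\nu=\frac{\beta\delta-\alpha\gamma}{\Delta^2}$.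
   Formalization: In (3) the sign s_2 is taken as -s_1 sgn(λw) instead of sgn(λw); the two agree for γ<0, while for γ>0 the printed sign makes both arcosh arguments less than -1 on all of int J^+ with w≠0, so the printed formula is undefined there. *)

theory Defs
  imports "HOL-Analysis.Analysis"
begin

definition aff_group :: "(real \<times> real) set" where
  "aff_group = {q. 0 < snd q}"

definition aff_mult :: "real \<times> real \<Rightarrow> real \<times> real \<Rightarrow> real \<times> real" where
  "aff_mult q p = (fst q + snd q * fst p, snd q * snd p)"

definition aff_id :: "real \<times> real" where
  "aff_id = (0, 1)"

(* Tangent vectors at a point of the group are pairs in the coordinates x, y;
   X1 and X2 are the fields y d/dx and y d/dy. *)

definition X1 :: "real \<times> real \<Rightarrow> real \<times> real" where
  "X1 q = (snd q, 0)"

definition X2 :: "real \<times> real \<Rightarrow> real \<times> real" where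
  "X2 q = (0, snd q)"

lemma X_left_invariant:
  assumes "(aff_mult q has_derivative D) (at p)"
  shows "D (X1 p) = X1 (aff_mult q p)" "D (X2 p) = X2 (aff_mult q p)"
proof -
  have "(aff_mult q has_derivative (\<lambda>h. (snd q * fst h, snd q * snd h))) (at p)"
    unfolding aff_mult_def by (auto intro!: derivative_eq_intros)
  then have "D = (\<lambda>h. (snd q * fst h, snd q * snd h))"
    using assms has_derivative_unique by blast
  then show "D (X1 p) = X1 (aff_mult q p)" "D (X2 p) = X2 (aff_mult q p)"
    by (simp_all add: X1_def X2_def aff_mult_def)
qed

definition frame_coords :: "real \<times> real \<Rightarrow> real \<times> real \<Rightarrow> real ^ 2" where
  "frame_coords q p = vector [fst p / snd q, snd p / snd q]"

lemma frame_coords_iff: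
  assumes "q \<in> aff_group"
  shows "p = u $ 1 *\<^sub>R X1 q + u $ 2 *\<^sub>R X2 q \<longleftrightarrow> u = frame_coords q p"
  using assms
  by (auto simp: aff_group_def frame_coords_def X1_def X2_def vec_eq_iff forall_2
      vector_2 prod_eq_iff field_simps)

definition lorentz_coords :: "real ^ 2 ^ 2 \<Rightarrow> real \<times> real \<Rightarrow> real \<times> real \<Rightarrow> real ^ 2" where
  "lorentz_coords A q p = A *v frame_coords q p"

definition lorentz_form :: "real ^ 2 ^ 2 \<Rightarrow> real \<times> real \<Rightarrow> real \<times> real \<Rightarrow> real" where
  "lorentz_form A q p = - (lorentz_coords A q p $ 1)\<^sup>2 + (lorentz_coords A q p $ 2)\<^sup>2"

(* The zero vector is included. *)

definition future_nonspacelike :: "real ^ 2 ^ 2 \<Rightarrow> real \<times> real \<Rightarrow> real \<times> real \<Rightarrow> bool" where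
  "future_nonspacelike A q p \<longleftrightarrow> lorentz_coords A q p $ 1 \<ge> \<bar>lorentz_coords A q p $ 2\<bar>"

(* A curve with compact image in the open half-plane is Lipschitz for the Euclidean distance
   iff it is Lipschitz for the distance of any Riemannian metric on the group. *)

definition future_curve :: "real ^ 2 ^ 2 \<Rightarrow> real \<Rightarrow> real \<Rightarrow> (real \<Rightarrow> real \<times> real) \<Rightarrow> bool" where
  "future_curve A t0 t1 \<zeta> \<longleftrightarrow>
     t0 < t1 \<and> (\<exists>C. C-lipschitz_on {t0..t1} \<zeta>) \<and> \<zeta> ` {t0..t1} \<subseteq> aff_group \<and>
     (AE t in lebesgue. t \<in> {t0..t1} \<longrightarrow>
        \<zeta> differentiable (at t) \<and>
        future_nonspacelike A (\<zeta> t) (vector_derivative \<zeta> (at t)))"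

definition lorentz_length :: "real ^ 2 ^ 2 \<Rightarrow> real \<Rightarrow> real \<Rightarrow> (real \<Rightarrow> real \<times> real) \<Rightarrow> real" where
  "lorentz_length A t0 t1 \<zeta> =
     (LINT t:{t0..t1}|lebesgue. sqrt (- lorentz_form A (\<zeta> t) (vector_derivative \<zeta> (at t))))"

definition curve_lengths :: "real ^ 2 ^ 2 \<Rightarrow> real \<times> real \<Rightarrow> real \<times> real \<Rightarrow> real set" where
  "curve_lengths A q0 q1 =
     {lorentz_length A t0 t1 \<zeta> | t0 t1 \<zeta>. future_curve A t0 t1 \<zeta> \<and> \<zeta> t0 = q0 \<and> \<zeta> t1 = q1}"

definition lorentz_dist :: "real ^ 2 ^ 2 \<Rightarrow> real \<times> real \<Rightarrow> real \<times> real \<Rightarrow> ereal" where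
  "lorentz_dist A q0 q1 =
     (if curve_lengths A q0 q1 = {} then 0 else (SUP l\<in>curve_lengths A q0 q1. ereal l))"

definition causal_future :: "real ^ 2 ^ 2 \<Rightarrow> (real \<times> real) set" where
  "causal_future A =
     {q. \<exists>t0 t1 \<zeta>. future_curve A t0 t1 \<zeta> \<and> \<zeta> t0 = aff_id \<and> \<zeta> t1 = q}"

(* The sectional curvature of the left-invariant metric is constant on the group; this is its
   value in terms of the matrix. *)

definition sectional_curvature :: "real ^ 2 ^ 2 \<Rightarrow> real" where
  "sectional_curvature A = ((A $ 2 $ 1)\<^sup>2 - (A $ 1 $ 1)\<^sup>2) / (det A)\<^sup>2"

definition inv_alpha :: "real ^ 2 ^ 2 \<Rightarrow> real" where
  "inv_alpha A = matrix_inv A $ 1 $ 1"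

definition inv_beta :: "real ^ 2 ^ 2 \<Rightarrow> real" where
  "inv_beta A = matrix_inv A $ 1 $ 2"

definition inv_gamma :: "real ^ 2 ^ 2 \<Rightarrow> real" where
  "inv_gamma A = matrix_inv A $ 2 $ 1"

definition inv_delta :: "real ^ 2 ^ 2 \<Rightarrow> real" where
  "inv_delta A = matrix_inv A $ 2 $ 2"

lemma matrix_inv_2:
  assumes "det (A :: real ^ 2 ^ 2) \<noteq> 0"
  shows "inv_alpha A = A $ 2 $ 2 / det A" "inv_beta A = - A $ 1 $ 2 / det A"
    "inv_gamma A = - A $ 2 $ 1 / det A" "inv_delta A = A $ 1 $ 1 / det A"
proof -
  define B :: "real ^ 2 ^ 2" where
    "B = vector [vector [A $ 2 $ 2 / det A, - A $ 1 $ 2 / det A],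
                 vector [- A $ 2 $ 1 / det A, A $ 1 $ 1 / det A]]"
  have "B ** A = mat 1"
    using assms
    by (simp add: B_def vec_eq_iff matrix_matrix_mult_def sum_2 forall_2 vector_2 mat_def det_2
        divide_simps)
  moreover have "A ** matrix_inv A = mat 1"
    using assms invertible_det_nz[of A] unfolding invertible_def matrix_inv_def
    by (metis (mono_tags, lifting) someI_ex)
  ultimately have "matrix_inv A = B"
    by (metis matrix_mul_assoc matrix_mul_lid matrix_mul_rid)
  then show "inv_alpha A = A $ 2 $ 2 / det A" "inv_beta A = - A $ 1 $ 2 / det A"
    "inv_gamma A = - A $ 2 $ 1 / det A" "inv_delta A = A $ 1 $ 1 / det A"
    by (simp_all add: inv_alpha_def inv_beta_def inv_gamma_def inv_delta_def B_def vector_2)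
qed

lemma sectional_curvature_eq:
  assumes "det A \<noteq> 0"
  shows "sectional_curvature A = (inv_gamma A)\<^sup>2 - (inv_delta A)\<^sup>2"
  using matrix_inv_2[OF assms]
  by (simp add: sectional_curvature_def power_divide diff_divide_distrib)

definition Delta :: "real ^ 2 ^ 2 \<Rightarrow> real" where
  "Delta A = sqrt ((inv_gamma A)\<^sup>2 - (inv_delta A)\<^sup>2)"

definition lambda_par :: "real ^ 2 ^ 2 \<Rightarrow> real" where
  "lambda_par A = (inv_alpha A * inv_delta A - inv_beta A * inv_gamma A) / (Delta A)\<^sup>2"

definition nu_par :: "real ^ 2 ^ 2 \<Rightarrow> real" where
  "nu_par A = (inv_beta A * inv_delta A - inv_alpha A * inv_gamma A) / (Delta A)\<^sup>2"

definition w_coord :: "real ^ 2 ^ 2 \<Rightarrow> real \<times> real \<Rightarrow> real" where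
  "w_coord A q = (fst q + nu_par A * (snd q - 1)) / lambda_par A"

definition sign1 :: "real ^ 2 ^ 2 \<Rightarrow> real" where
  "sign1 A = sgn (inv_gamma A)"

(* In the coordinates (w, y) the causal future of the identity is the cone
   s1 * (y - 1) >= |w|, y > 0.  On its interior with w nonzero, both quotients to which arcosh is
   applied below have the sign of -w if s1 = 1 (where y > 1 + |w|) and the sign of w if s1 = -1
   (where y < 1 - |w|).  The sign that makes them greater than 1 is thus -s1 * sgn (lambda * w),
   lambda being positive; it equals sgn (lambda * w) exactly when s1 = -1, and for s1 = 1
   the latter sign would leave the domain [1, oo) of arcosh. *)

definition sign2 :: "real ^ 2 ^ 2 \<Rightarrow> real \<times> real \<Rightarrow> real" where
  "sign2 A q = - sign1 A * sgn (lambda_par A * w_coord A q)"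

definition tau :: "real ^ 2 ^ 2 \<Rightarrow> real \<times> real \<Rightarrow> real" where
  "tau A q =
     arcosh (sign2 A q * ((1 - (snd q)\<^sup>2 - (w_coord A q)\<^sup>2) / (2 * snd q * w_coord A q)))"

definition rho :: "real ^ 2 ^ 2 \<Rightarrow> real \<times> real \<Rightarrow> real" where
  "rho A q = arcosh (sign2 A q * ((1 - (snd q)\<^sup>2 + (w_coord A q)\<^sup>2) / (2 * w_coord A q)))"

end

theory Submission
  imports Defs "HOL-Real_Asymp.Real_Asymp"
begin

text \<open>
  In the coordinates $(w,y)$ on the group the Lorentzian length element is
  $\sqrt{dy^2-dw^2}/(y\Delta)$, and future directed means $s\,dy \ge |dw|$, where $s = \pm1$ is the sign
  of $\gamma$ (lorentz_form_eq, future_nonspacelike_iff). The light cones are those of the plane,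
  so $J^+$ is the cone $s(y-1) \ge |w|$ (causal_future_eq).

  The metric does not depend on $w$, so geodesics have a conserved momentum $p$. For each real $p$
  the covector $(s\sqrt{1+p^2y^2}, -py)/(y\Delta)$ has unit Lorentzian norm and is exact. The reverse
  Cauchy--Schwarz inequality bounds the length of every future curve by the increment of its
  potential, and the bound is an equality along the geodesic with momentum $p$
  (length_vs_potential). So this geodesic is longest between its endpoints, and the potential
  gives the distance (dist_geodesic_endpoint). Each interior point of the cone is the
  endpoint of one of these geodesics; the line $w = 0$ has $p = 0$ and length $|\ln y_1|/\Delta$. For
  $w \neq 0$, the substitution $|p| = 1/\sinh\rho$, $y_1 = \sinh\rho/\sinh\tau$ turns the potential
  difference into $s(\rho-\tau)/\Delta$ and solves for $\rho$ and $\tau$ in terms of the endpoint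
  (dist_hyperbolic, interior_hyperbolic). On the boundary of the cone the
  bounds given by momenta with the sign of $w$ tend to $0$ as $|p| \to \infty$ (dist_frontier).

  Since the curves are only Lipschitz, the comparison of length and potential uses the fundamental
  theorem of calculus for Lipschitz functions (lipschitz_fundamental_theorem).
\<close>

section \<open>Fundamental theorem of calculus for Lipschitz functions\<close>

text \<open>
  The difference quotients of a Lipschitz function are bounded by its Lipschitz constant, so
  dominated convergence passes the fundamental theorem of calculus from them to their limit, the
  derivative. Nonspacelike curves are Lipschitz with a velocity almost everywhere, and this is the
  link between their velocity and their endpoints.
\<close>

lemma lipschitz_fundamental_theorem:
  fixes f f' :: "real \<Rightarrow> real"
  assumes ab: "a < b" and lip: "C-lipschitz_on {a..b} f"
    and der: "AE t in lebesgue. t \<in> {a..b} \<longrightarrow> (f has_real_derivative f' t) (at t)"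
  shows "set_integrable lebesgue {a..b} f'" "(LINT t:{a..b}|lebesgue. f' t) = f b - f a"
proof -
  \<comment> \<open>Constant extension beyond the interval, so that forward difference quotients exist at every point.\<close>
  define g where "g t = f (max a (min b t))" for t
  have C: "0 \<le> C"
    using lip by (rule lipschitz_on_nonneg)
  have g_lip: "\<bar>g t - g u\<bar> \<le> C * \<bar>t - u\<bar>" for t u
  proof -
    have "\<bar>g t - g u\<bar> \<le> C * \<bar>max a (min b t) - max a (min b u)\<bar>"
      using lipschitz_onD[OF lip, of "max a (min b t)" "max a (min b u)"] ab
      by (simp add: g_def dist_real_def)
    also have "\<dots> \<le> C * \<bar>t - u\<bar>"
      by (intro mult_left_mono C) (auto simp: max_def min_def)
    finally show ?thesis .
  qed
  have g_cont: "continuous_on S g" for S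
  proof -
    have "C-lipschitz_on S g"
      using g_lip C by (auto simp: lipschitz_on_def dist_real_def)
    then show ?thesis
      by (rule lipschitz_on_continuous_on)
  qed
  define h where "h n = 1 / real (Suc n)" for n
  have h: "0 < h n" "h n \<le> 1" for n
    by (auto simp: h_def)
  have h_lim: "h \<longlonglongrightarrow> 0"
    unfolding h_def by (rule LIMSEQ_inverse_real_of_nat[unfolded inverse_eq_divide])
  have h_at_0: "filterlim h (at 0) sequentially"
    using h_lim h(1) by (auto simp: filterlim_at less_imp_neq[symmetric])
  define D where "D n t = (g (t + h n) - g t) / h n" for n t
  have D_cont: "continuous_on S (D n)" for S n
    unfolding D_def using h(1)[of n]
    by (intro continuous_intros continuous_on_compose2[OF g_cont[of UNIV]]) auto
  have D_bound: "\<bar>D n t\<bar> \<le> C" for n t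
  proof -
    have "\<bar>g (t + h n) - g t\<bar> \<le> C * h n"
      using g_lip[of "t + h n" t] h(1)[of n] by simp
    then show ?thesis
      unfolding D_def abs_divide using h(1)[of n] by (simp add: pos_divide_le_eq)
  qed
  have D_lim: "(\<lambda>n. D n t) \<longlonglongrightarrow> f' t"
    if t: "t \<in> {a<..<b}" and "(f has_real_derivative f' t) (at t)" for t
  proof -
    have "(g has_real_derivative f' t) (at t)"
      using that(2)
    proof (rule has_field_derivative_transform_within_open)
      show "open {a<..<b}" by simp
    qed (use t in \<open>auto simp: g_def\<close>)
    then have "((\<lambda>k. (g (t + k) - g t) / k) \<longlongrightarrow> f' t) (at 0)"
      by (simp add: DERIV_def)
    then show ?thesis
      unfolding D_def using h_at_0 by (rule filterlim_compose)
  qed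
  have not_end: "AE t in lebesgue. t \<noteq> a \<and> t \<noteq> b"
    using AE_lborel_singleton[of a] AE_lborel_singleton[of b] by (auto intro: AE_completion)
  define s where "s n t = indicator {a..b} t *\<^sub>R D n t" for n t
  have s_meas: "s n \<in> borel_measurable lebesgue" for n
  proof -
    have [measurable]: "D n \<in> borel_measurable borel"
      by (rule borel_measurable_continuous_onI[OF D_cont])
    show ?thesis
      unfolding s_def by (rule measurable_completion) measurable
  qed
  have s_lim: "AE t in lebesgue. (\<lambda>n. s n t) \<longlonglongrightarrow> indicator {a..b} t *\<^sub>R f' t"
    using der not_end
  proof eventually_elim
    case (elim t)
    show ?case
    proof (cases "t \<in> {a..b}")
      case True
      then have "t \<in> {a<..<b}" using elim by auto
      with D_lim[of t] elim True show ?thesis by (simp add: s_def)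
    qed (simp add: s_def)
  qed
  have f'_meas: "(\<lambda>t. indicator {a..b} t *\<^sub>R f' t) \<in> borel_measurable lebesgue"
  proof (rule borel_measurable_AE)
    show "(\<lambda>t. lim (\<lambda>n. s n t)) \<in> borel_measurable lebesgue"
      using s_meas by (rule borel_measurable_lim_metric)
    show "AE t in lebesgue. lim (\<lambda>n. s n t) = indicator {a..b} t *\<^sub>R f' t"
      using s_lim by eventually_elim (rule limI)
  qed
  have w: "integrable lebesgue (\<lambda>t. C * indicator {a..b} t)"
    using ab by (intro integrable_mult_right integrable_real_indicator) (auto simp: emeasure_lborel_Icc)
  have s_bound: "AE t in lebesgue. norm (s n t) \<le> C * indicator {a..b} t" for n
    using D_bound C by (intro AE_I2) (auto simp: s_def indicator_def)
  show "set_integrable lebesgue {a..b} f'"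
    unfolding set_integrable_def
    by (rule integrable_dominated_convergence[OF f'_meas s_meas w s_lim s_bound])
  have conv: "(\<lambda>n. integral\<^sup>L lebesgue (s n)) \<longlonglongrightarrow> (LINT t:{a..b}|lebesgue. f' t)"
    unfolding set_lebesgue_integral_def
    by (rule integral_dominated_convergence[OF f'_meas s_meas w s_lim s_bound])
  \<comment> \<open>The integral of a difference quotient of g is a difference of difference quotients of a primitive of g.\<close>
  obtain P where P: "\<And>t. t \<in> {a - 1..b + 2} \<Longrightarrow> (P has_vector_derivative g t) (at t within {a - 1..b + 2})"
    using antiderivative_continuous[OF g_cont] by blast
  have P': "(P has_real_derivative g t) (at t)" if "t \<in> {a..b + 1}" for t
    using P[of t] that
    by (auto simp: has_real_derivative_iff_has_vector_derivative at_within_Icc_at)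
  have s_int: "integral\<^sup>L lebesgue (s n) = (P (b + h n) - P b) / h n - (P (a + h n) - P a) / h n" for n
  proof -
    have "(D n has_integral (P (b + h n) - P b) / h n - (P (a + h n) - P a) / h n) {a..b}"
    proof (rule fundamental_theorem_of_calculus)
      show "((\<lambda>t. (P (t + h n) - P t) / h n) has_vector_derivative D n t) (at t within {a..b})"
        if "t \<in> {a..b}" for t
      proof -
        have 1: "(P has_real_derivative g t) (at t)"
          using that by (intro P') auto
        have "((\<lambda>t. P (t + h n)) has_real_derivative g (t + h n) * 1) (at t)"
          using that h[of n]
          by (intro DERIV_chain2[of P] P' derivative_eq_intros) auto
        then have "((\<lambda>t. (P (t + h n) - P t) / h n) has_real_derivative D n t) (at t)"
          unfolding D_def using 1 by (intro DERIV_cdivide DERIV_diff) auto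
        then show ?thesis
          by (simp add: has_real_derivative_iff_has_vector_derivative has_vector_derivative_at_within)
      qed
    qed (use ab in \<open>simp add: diff_divide_distrib\<close>)+
    moreover have "integral\<^sup>L lebesgue (s n) = integral {a..b} (D n)"
      using set_lebesgue_integral_eq_integral(2)[of "{a..b}" "D n"]
        absolutely_integrable_continuous_real[OF D_cont, of a b n]
      by (simp add: set_lebesgue_integral_def s_def[abs_def])
    ultimately show ?thesis
      by (simp add: integral_unique)
  qed
  have P_lim: "(\<lambda>n. (P (t + h n) - P t) / h n) \<longlonglongrightarrow> g t" if "t \<in> {a..b}" for t
  proof -
    have "((\<lambda>k. (P (t + k) - P t) / k) \<longlongrightarrow> g t) (at 0)"
      using P'[of t] that by (simp add: DERIV_def)
    then show ?thesis
      using h_at_0 by (rule filterlim_compose)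
  qed
  have "(\<lambda>n. integral\<^sup>L lebesgue (s n)) \<longlonglongrightarrow> g b - g a"
    unfolding s_int using ab by (intro tendsto_diff P_lim) auto
  with conv have "(LINT t:{a..b}|lebesgue. f' t) = g b - g a"
    by (rule LIMSEQ_unique)
  then show "(LINT t:{a..b}|lebesgue. f' t) = f b - f a"
    using ab by (simp add: g_def)
qed

section \<open>The plane coordinates w and y\<close>

text \<open>
  With velocity $p$ at $q = (x,y)$, the definitions of $\lambda$ and $\nu$ are tuned so that
  $dy = y(\gamma v_1 + \delta v_2)$ and $dw = -y(\delta v_1 + \gamma v_2)$. In the coordinates
  $(w,y)$ the form is therefore $(dw^2 - dy^2)/(y\Delta)^2$, whose light cones are the standard ones
  because $\gamma^2 - \delta^2 = \Delta^2 > 0$.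
\<close>

locale positive_curvature =
  fixes A :: "real ^ 2 ^ 2"
  assumes det_pos: "det A > 0" and curvature_pos: "sectional_curvature A > 0"
begin

abbreviation "s \<equiv> sign1 A"

lemma gamma_delta: "\<bar>inv_delta A\<bar> < \<bar>inv_gamma A\<bar>"
proof -
  have "(inv_delta A)\<^sup>2 < (inv_gamma A)\<^sup>2"
    using curvature_pos sectional_curvature_eq[of A] det_pos by simp
  then show ?thesis
    by (meson abs_le_square_iff not_le)
qed

lemma s_cases: "s = 1 \<or> s = - 1"
  using gamma_delta by (auto simp: sign1_def sgn_if)

lemma s_square [simp]: "s * s = 1" "s * (s * x) = x"
  using s_cases by auto

lemma s_gamma: "\<bar>inv_delta A\<bar> < s * inv_gamma A"
  using gamma_delta by (simp add: sign1_def sgn_mult_self_eq abs_sgn mult.commute)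

lemma Delta_square: "(Delta A)\<^sup>2 = (inv_gamma A)\<^sup>2 - (inv_delta A)\<^sup>2"
  using curvature_pos sectional_curvature_eq[of A] det_pos by (simp add: Delta_def)

lemma Delta_pos: "Delta A > 0"
  using curvature_pos sectional_curvature_eq[of A] det_pos by (simp add: Delta_def)

lemma row_norms: "0 < (A $ 2 $ 1)\<^sup>2 - (A $ 1 $ 1)\<^sup>2"
  using curvature_pos det_pos by (simp add: sectional_curvature_def zero_less_divide_iff)

lemma Delta_square_entries:
  "(Delta A)\<^sup>2 = ((A $ 2 $ 1)\<^sup>2 - (A $ 1 $ 1)\<^sup>2) / (det A)\<^sup>2"
  unfolding Delta_square using det_pos matrix_inv_2[of A]
  by (simp add: power_divide diff_divide_distrib)

lemma lambda_entries: "lambda_par A = det A / ((A $ 2 $ 1)\<^sup>2 - (A $ 1 $ 1)\<^sup>2)"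
proof -
  have "inv_alpha A * inv_delta A - inv_beta A * inv_gamma A = det A / (det A)\<^sup>2"
    using det_pos matrix_inv_2[of A]
    by (simp add: det_2[of A] power2_eq_square diff_divide_distrib algebra_simps)
  then show ?thesis
    using det_pos row_norms by (simp add: lambda_par_def Delta_square_entries)
qed

lemma lambda_pos: "lambda_par A > 0"
  using row_norms det_pos by (simp add: lambda_entries)

lemma nu_entries:
  "nu_par A = (A $ 2 $ 2 * A $ 2 $ 1 - A $ 1 $ 1 * A $ 1 $ 2)
     / ((A $ 2 $ 1)\<^sup>2 - (A $ 1 $ 1)\<^sup>2)"
proof -
  have "inv_beta A * inv_delta A - inv_alpha A * inv_gamma A
      = (A $ 2 $ 2 * A $ 2 $ 1 - A $ 1 $ 1 * A $ 1 $ 2) / (det A)\<^sup>2"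
    using det_pos matrix_inv_2[of A]
    by (simp add: power2_eq_square diff_divide_distrib algebra_simps)
  then show ?thesis
    using det_pos row_norms by (simp add: nu_par_def Delta_square_entries)
qed

text \<open>
  The linear part of the affine coordinate $w$, that is, its differential at every point.
\<close>

definition dw :: "real \<times> real \<Rightarrow> real" where
  "dw p = (fst p + nu_par A * snd p) / lambda_par A"

lemma dw_entries:
  "dw p = (((A $ 2 $ 1)\<^sup>2 - (A $ 1 $ 1)\<^sup>2) * fst p
     + (A $ 2 $ 2 * A $ 2 $ 1 - A $ 1 $ 1 * A $ 1 $ 2) * snd p) / det A"
  using row_norms det_pos unfolding dw_def nu_entries lambda_entries
  by (simp add: divide_simps)

lemma velocity_from_lorentz_coords:
  fixes p :: "real \<times> real"
  assumes "q \<in> aff_group"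
  defines "v \<equiv> lorentz_coords A q p"
  shows "snd p = snd q * (inv_gamma A * v $ 1 + inv_delta A * v $ 2)"
    and "dw p = - snd q * (inv_delta A * v $ 1 + inv_gamma A * v $ 2)"
proof -
  have y: "0 < snd q"
    using assms(1) by (simp add: aff_group_def)
  have v1: "snd q * v $ 1 = A $ 1 $ 1 * fst p + A $ 1 $ 2 * snd p"
    and v2: "snd q * v $ 2 = A $ 2 $ 1 * fst p + A $ 2 $ 2 * snd p"
    using y unfolding v_def lorentz_coords_def frame_coords_def
    by (simp_all add: matrix_vector_mult_def sum_2 vector_2 field_simps)
  have "snd q * (inv_gamma A * v $ 1 + inv_delta A * v $ 2)
      = (A $ 1 $ 1 * (snd q * v $ 2) - A $ 2 $ 1 * (snd q * v $ 1)) / det A"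
    using det_pos by (simp add: matrix_inv_2[of A] field_simps)
  also have "\<dots> = det A * snd p / det A"
    unfolding v1 v2 det_2[of A] by (simp add: algebra_simps)
  finally show "snd p = snd q * (inv_gamma A * v $ 1 + inv_delta A * v $ 2)"
    using det_pos by simp
  have "- snd q * (inv_delta A * v $ 1 + inv_gamma A * v $ 2)
      = (A $ 2 $ 1 * (snd q * v $ 2) - A $ 1 $ 1 * (snd q * v $ 1)) / det A"
    using det_pos by (simp add: matrix_inv_2[of A] field_simps)
  also have "\<dots> = dw p"
    unfolding v1 v2 dw_entries by (simp add: algebra_simps power2_eq_square)
  finally show "dw p = - snd q * (inv_delta A * v $ 1 + inv_gamma A * v $ 2)"
    by simp
qed

text \<open>
  The linear map from $(v_1,v_2)$ to $(s\,dy, dw)$ sends the two light rays of one plane to those of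
  the other: $s\,dy \mp dw$ is a positive multiple of $v_1 \pm s\,v_2$. Positivity of the
  multiples $s\gamma \pm \delta$ is where the sign of the curvature enters.
\<close>

lemma future_nonspacelike_iff:
  assumes "q \<in> aff_group"
  shows "future_nonspacelike A q p \<longleftrightarrow> \<bar>dw p\<bar> \<le> s * snd p"
proof -
  define v1 v2 where "v1 = lorentz_coords A q p $ 1" and "v2 = lorentz_coords A q p $ 2"
  have y: "0 < snd q"
    using assms by (simp add: aff_group_def)
  note vel = velocity_from_lorentz_coords[OF assms, of p, folded v1_def v2_def]
  \<comment> \<open>Both light-cone coordinates at once, for sign +1 and -1.\<close>
  have minus: "s * snd p - \<sigma> * dw p = snd q * (s * inv_gamma A + \<sigma> * inv_delta A) * (v1 + s * \<sigma> * v2)"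
    if "\<sigma> * \<sigma> = 1" for \<sigma> :: real
  proof -
    have "(s * inv_gamma A + \<sigma> * inv_delta A) * (v1 + s * \<sigma> * v2)
      = s * inv_gamma A * v1 + \<sigma> * inv_delta A * v1 + (s * s) * \<sigma> * inv_gamma A * v2
         + (\<sigma> * \<sigma>) * s * inv_delta A * v2"
      by (simp only: algebra_simps)
    then show ?thesis
      unfolding vel using that by (simp add: algebra_simps)
  qed
  have pos: "0 < snd q * (s * inv_gamma A + \<sigma> * inv_delta A)" if "\<sigma> = 1 \<or> \<sigma> = - 1" for \<sigma> :: real
    using that s_gamma y by (intro mult_pos_pos) auto
  have "0 \<le> s * snd p - \<sigma> * dw p \<longleftrightarrow> 0 \<le> v1 + s * \<sigma> * v2" if "\<sigma> = 1 \<or> \<sigma> = - 1" for \<sigma> :: real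
  proof -
    have "\<sigma> * \<sigma> = 1" using that by auto
    show ?thesis
      unfolding minus[OF \<open>\<sigma> * \<sigma> = 1\<close>] using mult_le_cancel_left_pos[OF pos[OF that], of 0]
      by (simp only: mult_zero_right)
  qed
  from this[of 1] this[of "- 1"] show ?thesis
    using s_cases unfolding future_nonspacelike_def v1_def[symmetric] v2_def[symmetric]
    by (auto simp: abs_le_iff)
qed

lemma lorentz_form_eq:
  assumes "q \<in> aff_group"
  shows "- lorentz_form A q p = ((snd p)\<^sup>2 - (dw p)\<^sup>2) / (snd q * Delta A)\<^sup>2"
proof -
  define v1 v2 where "v1 = lorentz_coords A q p $ 1" and "v2 = lorentz_coords A q p $ 2"
  have y: "0 < snd q"
    using assms by (simp add: aff_group_def)
  have "(snd p)\<^sup>2 - (dw p)\<^sup>2 = (snd q * Delta A)\<^sup>2 * (v1\<^sup>2 - v2\<^sup>2)"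
    unfolding velocity_from_lorentz_coords[OF assms, of p, folded v1_def v2_def] power_mult_distrib Delta_square
    by (simp add: algebra_simps power2_eq_square)
  then show ?thesis
    using y Delta_pos by (simp add: lorentz_form_def v1_def v2_def)
qed

lemma w_coord_id [simp]: "w_coord A aff_id = 0"
  by (simp add: w_coord_def aff_id_def)

end

section \<open>Calibrating covectors\<close>

text \<open>
  The pair $(\sqrt{1+p^2y^2},\, py)$ is a unit timelike covector in the plane, hence the hyperbolic
  cosine and sine of a rapidity; $p$ is the momentum conjugate to the cyclic coordinate $w$, which is
  constant along geodesics.
\<close>

definition boost :: "real \<Rightarrow> real \<Rightarrow> real" where
  "boost p y = sqrt (1 + p\<^sup>2 * y\<^sup>2)"

lemma boost_square: "(boost p y)\<^sup>2 = 1 + p\<^sup>2 * y\<^sup>2"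
  unfolding boost_def by (rule real_sqrt_pow2) (simp add: add_nonneg_nonneg)

lemma boost_ge_1: "1 \<le> boost p y"
  by (simp add: boost_def)

lemma boost_pos: "0 < boost p y"
  using boost_ge_1[of p y] by linarith

lemma abs_le_boost: "\<bar>p * y\<bar> \<le> boost p y"
  unfolding boost_def by (rule real_le_rsqrt) (simp add: power_mult_distrib)

lemma boost_le: "0 \<le> y \<Longrightarrow> boost p y \<le> 1 + \<bar>p\<bar> * y"
  unfolding boost_def by (rule real_le_lsqrt) (auto simp: power2_eq_square algebra_simps)

lemma boost_0 [simp]: "boost 0 y = 1"
  by (simp add: boost_def)

lemma boost_derivative: "(boost p has_real_derivative p\<^sup>2 * y / boost p y) (at y)"
proof -
  have pos: "0 < 1 + p\<^sup>2 * y\<^sup>2"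
    by (simp add: add_pos_nonneg)
  show ?thesis
    unfolding boost_def using pos
    by (auto intro!: derivative_eq_intros simp: field_simps)
qed

text \<open>
  A primitive of $\sqrt{1+p^2y^2}/y$, in a form that makes sense for $p = 0$ as well.
\<close>

definition calibration :: "real \<Rightarrow> real \<Rightarrow> real" where
  "calibration p y = boost p y + ln y - ln (1 + boost p y)"

lemma calibration_derivative:
  assumes "0 < y"
  shows "(calibration p has_real_derivative boost p y / y) (at y)"
proof -
  define S where "S = boost p y"
  have S: "0 < S" "S\<^sup>2 = 1 + p\<^sup>2 * y\<^sup>2"
    using boost_pos boost_square by (auto simp: S_def)
  have "(calibration p has_real_derivative p\<^sup>2 * y / S + 1 / y - (p\<^sup>2 * y / S) / (1 + S)) (at y)"
    unfolding calibration_def S_def using assms boost_pos[of p y]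
    by (auto intro!: derivative_eq_intros boost_derivative)
  also have "p\<^sup>2 * y / S + 1 / y - (p\<^sup>2 * y / S) / (1 + S) = (p\<^sup>2 * y\<^sup>2 + 1 + S) / (y * (1 + S))"
    using S(1) assms by (simp add: divide_simps) (simp add: algebra_simps power2_eq_square)
  also have "\<dots> = S / y"
    using S(1) assms unfolding S(2)[symmetric, simplified add.commute]
    by (simp add: divide_simps) (use S(2) in \<open>simp add: algebra_simps power2_eq_square\<close>)
  finally show ?thesis
    by (simp add: S_def)
qed

lemma calibration_lipschitz:
  assumes "0 < m"
  shows "(1 / m + \<bar>p\<bar>)-lipschitz_on {m..} (calibration p)"
proof (rule bounded_derivative_imp_lipschitz)
  fix y assume y: "y \<in> {m..}"
  then show "(calibration p has_derivative (*) (boost p y / y)) (at y within {m..})"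
    using calibration_derivative[of y p] assms
    by (auto simp: has_field_derivative_def intro: has_derivative_at_withinI)
  have "boost p y / y \<le> (1 + \<bar>p\<bar> * y) / y"
    using y assms by (intro divide_right_mono boost_le) auto
  also have "\<dots> = 1 / y + \<bar>p\<bar>"
    using y assms by (simp add: add_divide_distrib)
  also have "\<dots> \<le> 1 / m + \<bar>p\<bar>"
    using y assms by (simp add: frac_le)
  finally have "\<bar>boost p y / y\<bar> \<le> 1 / m + \<bar>p\<bar>"
    using boost_pos[of p y] y assms by simp
  moreover have "onorm ((*) (boost p y / y)) \<le> \<bar>boost p y / y\<bar>"
    by (rule onorm_le) (simp add: abs_mult)
  ultimately show "onorm ((*) (boost p y / y)) \<le> 1 / m + \<bar>p\<bar>"
    by linarith
qed (use assms in auto)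

text \<open>
  A unit timelike covector $(S, r)$ bounds the Lorentzian norm of every future vector $(a,b)$ from
  above, with equality for the direction dual to it, because $(Sa-rb)^2$ exceeds $a^2-b^2$ by the
  square $(ra-Sb)^2$.
\<close>

lemma reverse_cauchy_schwarz:
  fixes a b r S :: real
  assumes "\<bar>b\<bar> \<le> a" and "0 < S" "S\<^sup>2 = 1 + r\<^sup>2"
  shows "sqrt (a\<^sup>2 - b\<^sup>2) \<le> S * a - r * b"
    and "r * a = S * b \<Longrightarrow> sqrt (a\<^sup>2 - b\<^sup>2) = S * a - r * b"
proof -
  have "\<bar>r\<bar> \<le> \<bar>S\<bar>"
    unfolding abs_le_square_iff using assms(3) by simp
  then have "\<bar>r\<bar> \<le> S"
    using assms(2) by simp
  then have "\<bar>r * b\<bar> \<le> S * a"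
    using assms unfolding abs_mult by (intro mult_mono) auto
  then have nonneg: "0 \<le> S * a - r * b"
    by linarith
  have id: "(S * a - r * b)\<^sup>2 = (a\<^sup>2 - b\<^sup>2) + (r * a - S * b)\<^sup>2"
    using assms(3) by algebra
  show "sqrt (a\<^sup>2 - b\<^sup>2) \<le> S * a - r * b"
    using nonneg id by (intro real_le_lsqrt) auto
  show "sqrt (a\<^sup>2 - b\<^sup>2) = S * a - r * b" if "r * a = S * b"
    using nonneg id that by (intro real_sqrt_unique) auto
qed

section \<open>Length of future curves\<close>

context positive_curvature
begin

definition of_chart :: "real \<Rightarrow> real \<Rightarrow> real \<times> real" where
  "of_chart w y = (lambda_par A * w - nu_par A * (y - 1), y)"

lemma of_chart_simps [simp]: "snd (of_chart w y) = y" "w_coord A (of_chart w y) = w"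
  "of_chart (w_coord A q) (snd q) = q" "of_chart 0 1 = aff_id"
  using lambda_pos by (auto simp: of_chart_def w_coord_def prod_eq_iff aff_id_def)

lemma w_coord_lipschitz: "\<exists>C. C-lipschitz_on S (w_coord A)"
proof -
  have fs: "1-lipschitz_on S (fst :: real \<times> real \<Rightarrow> real)" "1-lipschitz_on S (snd :: real \<times> real \<Rightarrow> real)"
    by (auto simp: lipschitz_on_def dist_fst_le dist_snd_le)
  have eq: "w_coord A = (\<lambda>q. (1 / lambda_par A) * (fst q + nu_par A * (snd q - 1)))"
    by (auto simp: w_coord_def)
  have "(\<bar>1 / lambda_par A\<bar> * (1 + \<bar>nu_par A\<bar> * (1 + 0)))-lipschitz_on S
      (\<lambda>q. (1 / lambda_par A) * (fst q + nu_par A * (snd q - 1)))"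
    by (intro lipschitz_intros fs)
  then show ?thesis
    unfolding eq ..
qed

lemma future_curve_lipschitz:
  assumes "future_curve A t0 t1 \<zeta>"
  shows "\<exists>C. C-lipschitz_on {t0..t1} (\<lambda>t. snd (\<zeta> t))"
    and "\<exists>C. C-lipschitz_on {t0..t1} (\<lambda>t. w_coord A (\<zeta> t))"
    and "\<exists>C. C-lipschitz_on {t0..t1} (\<lambda>t. calibration p (snd (\<zeta> t)))"
proof -
  obtain C where C: "C-lipschitz_on {t0..t1} \<zeta>"
    using assms by (auto simp: future_curve_def)
  have "1-lipschitz_on (\<zeta> ` {t0..t1}) snd"
    by (auto simp: lipschitz_on_def dist_snd_le)
  from lipschitz_on_compose2[OF C this] have y: "C-lipschitz_on {t0..t1} (\<lambda>t. snd (\<zeta> t))"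
    by simp
  then show "\<exists>C. C-lipschitz_on {t0..t1} (\<lambda>t. snd (\<zeta> t))" ..
  obtain D where "D-lipschitz_on (\<zeta> ` {t0..t1}) (w_coord A)"
    using w_coord_lipschitz by blast
  from lipschitz_on_compose2[OF C this]
  show "\<exists>C. C-lipschitz_on {t0..t1} (\<lambda>t. w_coord A (\<zeta> t))" ..
  have "\<exists>t\<in>{t0..t1}. \<forall>u\<in>{t0..t1}. snd (\<zeta> t) \<le> snd (\<zeta> u)"
    using assms lipschitz_on_continuous_on[OF y]
    by (intro continuous_attains_inf) (auto simp: future_curve_def)
  \<comment> \<open>The calibration is Lipschitz only away from y = 0; a curve has compact image and stays away from it.\<close>
  then obtain m where m: "0 < m" "\<And>u. u \<in> {t0..t1} \<Longrightarrow> m \<le> snd (\<zeta> u)"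
    using assms by (auto simp: future_curve_def aff_group_def)
  have "(1 / m + \<bar>p\<bar>)-lipschitz_on ((\<lambda>t. snd (\<zeta> t)) ` {t0..t1}) (calibration p)"
    using m by (intro lipschitz_on_subset[OF calibration_lipschitz]) auto
  from lipschitz_on_compose2[OF y this]
  show "\<exists>C. C-lipschitz_on {t0..t1} (\<lambda>t. calibration p (snd (\<zeta> t)))" ..
qed

lemma future_curve_velocity:
  assumes "future_curve A t0 t1 \<zeta>"
  shows "AE t in lebesgue. t \<in> {t0..t1} \<longrightarrow> 
      ((\<lambda>t. snd (\<zeta> t)) has_real_derivative snd (vector_derivative \<zeta> (at t))) (at t) \<and>
      ((\<lambda>t. w_coord A (\<zeta> t)) has_real_derivative dw (vector_derivative \<zeta> (at t))) (at t) \<and>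
      \<bar>dw (vector_derivative \<zeta> (at t))\<bar> \<le> s * snd (vector_derivative \<zeta> (at t)) \<and>
      \<zeta> t \<in> aff_group"
proof -
  have "AE t in lebesgue. t \<in> {t0..t1} \<longrightarrow>
        \<zeta> differentiable (at t) \<and> future_nonspacelike A (\<zeta> t) (vector_derivative \<zeta> (at t))"
    using assms by (simp add: future_curve_def)
  then show ?thesis
  proof eventually_elim
    case (elim t)
    show ?case
    proof
      assume t: "t \<in> {t0..t1}"
      define V where "V = vector_derivative \<zeta> (at t)"
      have "(\<zeta> has_vector_derivative V) (at t)"
        using elim t by (auto simp: V_def simp flip: vector_derivative_works)
      then have x: "((\<lambda>t. fst (\<zeta> t)) has_real_derivative fst V) (at t)"
        and y: "((\<lambda>t. snd (\<zeta> t)) has_real_derivative snd V) (at t)"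
        by (auto simp: has_real_derivative_iff_has_vector_derivative
            intro: bounded_linear.has_vector_derivative bounded_linear_fst bounded_linear_snd)
      have w: "((\<lambda>t. w_coord A (\<zeta> t)) has_real_derivative dw V) (at t)"
        unfolding w_coord_def dw_def using lambda_pos
        by (auto intro!: derivative_eq_intros x y)
      have "\<zeta> t \<in> aff_group"
        using assms t by (auto simp: future_curve_def)
      with x y w elim t show "((\<lambda>t. snd (\<zeta> t)) has_real_derivative snd (vector_derivative \<zeta> (at t))) (at t) \<and>
        ((\<lambda>t. w_coord A (\<zeta> t)) has_real_derivative dw (vector_derivative \<zeta> (at t))) (at t) \<and>
        \<bar>dw (vector_derivative \<zeta> (at t))\<bar> \<le> s * snd (vector_derivative \<zeta> (at t)) \<and>
        \<zeta> t \<in> aff_group"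
        by (simp add: V_def future_nonspacelike_iff)
    qed
  qed
qed

text \<open>
  Both $s\,y - w$ and $s\,y + w$ are nondecreasing along a future directed curve.
\<close>

lemma future_curve_causal_order:
  assumes "future_curve A t0 t1 \<zeta>"
  shows "\<bar>w_coord A (\<zeta> t1) - w_coord A (\<zeta> t0)\<bar> \<le> s * (snd (\<zeta> t1) - snd (\<zeta> t0))"
proof -
  have lt: "t0 < t1"
    using assms by (simp add: future_curve_def)
  have "\<sigma> * (w_coord A (\<zeta> t1) - w_coord A (\<zeta> t0)) \<le> s * (snd (\<zeta> t1) - snd (\<zeta> t0))"
    if "\<sigma> = 1 \<or> \<sigma> = - 1" for \<sigma>
  proof -
    let ?V = "\<lambda>t. vector_derivative \<zeta> (at t)"
    let ?f = "\<lambda>t. s * snd (\<zeta> t) - \<sigma> * w_coord A (\<zeta> t)"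
    obtain C D where "C-lipschitz_on {t0..t1} (\<lambda>t. snd (\<zeta> t))"
      and "D-lipschitz_on {t0..t1} (\<lambda>t. w_coord A (\<zeta> t))"
      using future_curve_lipschitz[OF assms] by blast
    then have lip: "(\<bar>s\<bar> * C + \<bar>\<sigma>\<bar> * D)-lipschitz_on {t0..t1} ?f"
      by (intro lipschitz_intros)
    have der: "AE t in lebesgue. t \<in> {t0..t1} \<longrightarrow>
      (?f has_real_derivative s * snd (?V t) - \<sigma> * dw (?V t)) (at t)"
      using future_curve_velocity[OF assms]
      by eventually_elim (auto intro!: derivative_eq_intros)
    have "0 \<le> (LINT t:{t0..t1}|lebesgue. s * snd (?V t) - \<sigma> * dw (?V t))"
      unfolding set_lebesgue_integral_def
    proof (rule integral_nonneg_AE)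
      show "AE t in lebesgue. 0 \<le> indicat_real {t0..t1} t *\<^sub>R (s * snd (?V t) - \<sigma> * dw (?V t))"
        using future_curve_velocity[OF assms]
        by eventually_elim (use that in \<open>auto simp: indicator_def abs_le_iff\<close>)
    qed
    also have "\<dots> = ?f t1 - ?f t0"
      by (rule lipschitz_fundamental_theorem(2)[OF lt lip der])
    finally show ?thesis
      by (simp add: algebra_simps)
  qed
  from this[of 1] this[of "- 1"] show ?thesis
    by (simp add: abs_le_iff)
qed

text \<open>
  The covector field $(s\sqrt{1+p^2y^2}, -py)/(y\Delta)$, of unit Lorentzian norm, is closed since $w$
  is cyclic; this is a primitive of it. It solves the eikonal equation of the metric and calibrates
  the geodesics with momentum $p$.
\<close>

definition potential :: "real \<Rightarrow> real \<times> real \<Rightarrow> real" where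
  "potential p q = (s * calibration p (snd q) - p * w_coord A q) / Delta A"

text \<open>
  Pointwise, the integrand of the length is at most the derivative of the potential along the curve,
  by the reverse Cauchy--Schwarz inequality, with equality when the velocity is dual to the covector
  field. One potential thus gives the upper bound for all curves and the exact length of a geodesic.
\<close>

lemma length_vs_potential:
  assumes curve: "future_curve A t0 t1 \<zeta>"
  shows "lorentz_length A t0 t1 \<zeta> \<le> potential p (\<zeta> t1) - potential p (\<zeta> t0)"
    and "(\<And>t. t \<in> {t0..t1} \<Longrightarrow> s * (p * snd (\<zeta> t) * snd (vector_derivative \<zeta> (at t)))
        = boost p (snd (\<zeta> t)) * dw (vector_derivative \<zeta> (at t)))
      \<Longrightarrow> lorentz_length A t0 t1 \<zeta> = potential p (\<zeta> t1) - potential p (\<zeta> t0)"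
proof -
  have lt: "t0 < t1"
    using curve by (simp add: future_curve_def)
  define V where "V t = vector_derivative \<zeta> (at t)" for t
  define y where "y t = snd (\<zeta> t)" for t
  let ?l = "\<lambda>t. sqrt (- lorentz_form A (\<zeta> t) (V t))"
  define F where "F t = (s * (boost p (y t) / y t * snd (V t)) - p * dw (V t)) / Delta A" for t
  note vel = future_curve_velocity[OF curve, folded V_def y_def]
  obtain C D where C: "C-lipschitz_on {t0..t1} (\<lambda>t. calibration p (y t))"
    and D: "D-lipschitz_on {t0..t1} (\<lambda>t. w_coord A (\<zeta> t))"
    using future_curve_lipschitz[OF curve] unfolding y_def by metis
  have pot: "potential p (\<zeta> t) = 1 / Delta A * (s * calibration p (y t) - p * w_coord A (\<zeta> t))" for t
    by (simp add: potential_def y_def)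
  have lip: "(\<bar>1 / Delta A\<bar> * (\<bar>s\<bar> * C + \<bar>p\<bar> * D))-lipschitz_on {t0..t1} (\<lambda>t. potential p (\<zeta> t))"
    unfolding pot by (intro lipschitz_intros C D)
  have der: "AE t in lebesgue. t \<in> {t0..t1} \<longrightarrow> ((\<lambda>t. potential p (\<zeta> t)) has_real_derivative F t) (at t)"
    using vel
  proof eventually_elim
    case (elim t)
    show ?case
    proof
      assume t: "t \<in> {t0..t1}"
      from elim t have "0 < y t"
        by (simp add: y_def aff_group_def)
      then have "((\<lambda>t. calibration p (y t)) has_real_derivative boost p (y t) / y t * snd (V t)) (at t)"
        using elim t unfolding y_def[symmetric] by (intro DERIV_chain2[OF calibration_derivative]) auto
      then show "((\<lambda>t. potential p (\<zeta> t)) has_real_derivative F t) (at t)"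
        unfolding pot F_def using elim t Delta_pos by (auto intro!: derivative_eq_intros)
    qed
  qed
  note ftc = lipschitz_fundamental_theorem[OF lt lip der]
  have len: "lorentz_length A t0 t1 \<zeta> = (LINT t:{t0..t1}|lebesgue. ?l t)"
    by (simp add: lorentz_length_def V_def)
  have pointwise: "?l t \<le> F t" "0 \<le> F t"
      "s * (p * y t * snd (V t)) = boost p (y t) * dw (V t) \<Longrightarrow> ?l t = F t"
    if "\<bar>dw (V t)\<bar> \<le> s * snd (V t)" "\<zeta> t \<in> aff_group" for t
  proof -
    have y: "0 < y t"
      using that by (simp add: y_def aff_group_def)
    have sq: "(s * snd (V t))\<^sup>2 = (snd (V t))\<^sup>2"
      by (simp add: power2_eq_square algebra_simps)
    have l: "?l t = sqrt ((s * snd (V t))\<^sup>2 - (dw (V t))\<^sup>2) / (y t * Delta A)"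
      using y Delta_pos unfolding lorentz_form_eq[OF that(2)] sq y_def[symmetric]
      by (simp add: real_sqrt_divide)
    have F: "F t = (boost p (y t) * (s * snd (V t)) - (p * y t) * dw (V t)) / (y t * Delta A)"
      using y Delta_pos by (simp add: F_def field_simps)
    note rcs = reverse_cauchy_schwarz[OF that(1) boost_pos[of p "y t"], of "p * y t"]
    have "?l t \<le> F t"
      unfolding l F using y Delta_pos
      by (intro divide_right_mono rcs(1)) (auto simp: boost_square power_mult_distrib)
    then show "?l t \<le> F t" .
    have "0 \<le> ?l t"
      using y Delta_pos that(1) unfolding l
      by (intro divide_nonneg_pos) (auto simp: abs_le_square_iff[symmetric])
    with \<open>?l t \<le> F t\<close> show "0 \<le> F t"
      by linarith
    show "?l t = F t" if "s * (p * y t * snd (V t)) = boost p (y t) * dw (V t)"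
      unfolding l F
      by (subst rcs(2)) (use that in \<open>auto simp: boost_square power_mult_distrib algebra_simps\<close>)
  qed
  have "lorentz_length A t0 t1 \<zeta> \<le> (LINT t:{t0..t1}|lebesgue. F t)"
    unfolding len set_lebesgue_integral_def
  proof (rule integral_mono_AE')
    show "integrable lebesgue (\<lambda>t. indicat_real {t0..t1} t *\<^sub>R F t)"
      using ftc(1) by (simp add: set_integrable_def)
    show "AE t in lebesgue. indicat_real {t0..t1} t *\<^sub>R ?l t \<le> indicat_real {t0..t1} t *\<^sub>R F t"
      using vel by eventually_elim (auto simp: indicator_def intro!: pointwise)
    show "AE t in lebesgue. 0 \<le> indicat_real {t0..t1} t *\<^sub>R F t"
      using vel by eventually_elim (auto simp: indicator_def intro!: pointwise)
  qed
  then show "lorentz_length A t0 t1 \<zeta> \<le> potential p (\<zeta> t1) - potential p (\<zeta> t0)"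
    unfolding ftc(2) .
  assume eq: "\<And>t. t \<in> {t0..t1} \<Longrightarrow> s * (p * snd (\<zeta> t) * snd (vector_derivative \<zeta> (at t)))
        = boost p (snd (\<zeta> t)) * dw (vector_derivative \<zeta> (at t))"
  have "AE t in lebesgue. t \<in> {t0..t1} \<longrightarrow> ((\<lambda>t. potential p (\<zeta> t)) has_real_derivative ?l t) (at t)"
    using vel der
  proof eventually_elim
    case (elim t)
    show ?case
    proof
      assume t: "t \<in> {t0..t1}"
      from elim t have "?l t = F t"
        by (intro pointwise(3)) (auto simp: eq V_def y_def)
      with elim t show "((\<lambda>t. potential p (\<zeta> t)) has_real_derivative ?l t) (at t)" by simp
    qed
  qed
  from lipschitz_fundamental_theorem(2)[OF lt lip this]
  show "lorentz_length A t0 t1 \<zeta> = potential p (\<zeta> t1) - potential p (\<zeta> t0)"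
    unfolding len .
qed

end

text \<open>
  As $p \to \infty$ the covectors become lightlike, and the calibration grows like $p\,y$.
\<close>

lemma calibration_asymptotics:
  fixes y :: real
  assumes "0 < y"
  shows "((\<lambda>p. calibration p y - calibration p 1 - p * (y - 1)) \<longlongrightarrow> 0) at_top"
  unfolding calibration_def boost_def using assms by real_asymp

lemma calibration_minus [simp]: "calibration (- p) y = calibration p y"
  by (simp add: calibration_def boost_def)

context positive_curvature
begin

section \<open>The causal future and its boundary\<close>

lemma snd_aff_id [simp]: "snd aff_id = 1"
  by (simp add: aff_id_def)

text \<open>
  Both kinds of curve constructed below, segments that fill the cone and geodesics, move uniformly in
  the coordinate $y$; the condition on $W'$ is that they are future directed.
\<close>

lemma chart_curve:
  fixes W W' :: "real \<Rightarrow> real" and y1 :: real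
  assumes y1: "0 < y1"
    and der: "\<And>t. t \<in> {0..1} \<Longrightarrow> (W has_real_derivative W' t) (at t)"
    and speed: "\<And>t. t \<in> {0..1} \<Longrightarrow> \<bar>W' t\<bar> \<le> s * (y1 - 1)"
  defines "\<zeta> \<equiv> \<lambda>t. of_chart (W t) (1 + t * (y1 - 1))"
  shows "future_curve A 0 1 \<zeta>"
    and "t \<in> {0..1} \<Longrightarrow> snd (vector_derivative \<zeta> (at t)) = y1 - 1"
    and "t \<in> {0..1} \<Longrightarrow> dw (vector_derivative \<zeta> (at t)) = W' t"
proof -
  let ?V = "\<lambda>t. (lambda_par A * W' t - nu_par A * (y1 - 1), y1 - 1)"
  have vel: "(\<zeta> has_vector_derivative ?V t) (at t)" if "t \<in> {0..1}" for t
    unfolding \<zeta>_def of_chart_def has_real_derivative_iff_has_vector_derivative[symmetric]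
    by (intro has_vector_derivative_Pair; unfold has_real_derivative_iff_has_vector_derivative[symmetric])
      (auto intro!: derivative_eq_intros der that)
  then have V: "vector_derivative \<zeta> (at t) = ?V t" if "t \<in> {0..1}" for t
    using that by (intro vector_derivative_at)
  have dwV: "dw (?V t) = W' t" for t
    using lambda_pos by (simp add: dw_def)
  show "snd (vector_derivative \<zeta> (at t)) = y1 - 1" if "t \<in> {0..1}"
    using V[OF that] by simp
  show "dw (vector_derivative \<zeta> (at t)) = W' t" if "t \<in> {0..1}"
    using V[OF that] dwV by simp
  have group: "\<zeta> t \<in> aff_group" if "t \<in> {0..1}" for t
  proof -
    have "0 < (1 - t) * 1 + t * y1"
      using that y1 by (cases "t = 0") (auto intro!: add_nonneg_pos)
    then show ?thesis
      by (simp add: \<zeta>_def aff_group_def algebra_simps)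
  qed
  have "(s * (y1 - 1))-lipschitz_on {0..1} W"
  proof (rule bounded_derivative_imp_lipschitz)
    show "(W has_derivative (*) (W' t)) (at t within {0..1})" if "t \<in> {0..1}" for t
      using der[OF that] by (auto simp: has_field_derivative_def intro: has_derivative_at_withinI)
    show "onorm ((*) (W' t)) \<le> s * (y1 - 1)" if "t \<in> {0..1}" for t
    proof -
      have "onorm ((*) (W' t)) \<le> \<bar>W' t\<bar>"
        by (rule onorm_le) (simp add: abs_mult)
      with speed[OF that] show ?thesis by linarith
    qed
    show "0 \<le> s * (y1 - 1)"
      using speed[of 0] by simp
  qed simp
  moreover have "\<bar>y1 - 1\<bar>-lipschitz_on {0..1} (\<lambda>t. 1 + t * (y1 - 1))"
    by (rule lipschitz_onI) (auto simp: dist_real_def abs_mult[symmetric] algebra_simps)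
  ultimately obtain C D where "C-lipschitz_on {0..1} W" "D-lipschitz_on {0..1} (\<lambda>t. 1 + t * (y1 - 1))"
    by blast
  then have "(sqrt ((\<bar>lambda_par A\<bar> * C + \<bar>nu_par A\<bar> * (D + 0))\<^sup>2 + D\<^sup>2))-lipschitz_on {0..1} \<zeta>"
    unfolding \<zeta>_def of_chart_def by (intro lipschitz_intros)
  moreover have "\<zeta> differentiable (at t) \<and> future_nonspacelike A (\<zeta> t) (vector_derivative \<zeta> (at t))"
    if "t \<in> {0..1}" for t
    using vel[OF that] V[OF that] speed[OF that] dwV[of t]
    by (simp add: differentiableI_vector future_nonspacelike_iff[OF group[OF that]])
  ultimately show "future_curve A 0 1 \<zeta>"
    unfolding future_curve_def using group by auto
qed

lemma causal_future_eq:
  "causal_future A = {q \<in> aff_group. \<bar>w_coord A q\<bar> \<le> s * (snd q - 1)}"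
proof (intro set_eqI iffI)
  fix q assume "q \<in> causal_future A"
  then obtain t0 t1 \<zeta> where \<zeta>: "future_curve A t0 t1 \<zeta>" "\<zeta> t0 = aff_id" "\<zeta> t1 = q"
    by (auto simp: causal_future_def)
  then have "q \<in> aff_group"
    by (auto simp: future_curve_def)
  with future_curve_causal_order[OF \<zeta>(1)] \<zeta>(2,3)
  show "q \<in> {q \<in> aff_group. \<bar>w_coord A q\<bar> \<le> s * (snd q - 1)}"
    by simp
next
  fix q assume q: "q \<in> {q \<in> aff_group. \<bar>w_coord A q\<bar> \<le> s * (snd q - 1)}"
  let ?\<zeta> = "\<lambda>t. of_chart (w_coord A q * t) (1 + t * (snd q - 1))"
  have "future_curve A 0 1 ?\<zeta>"
    using q by (intro chart_curve(1)[where W' = "\<lambda>_. w_coord A q"])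
      (auto simp: aff_group_def intro!: derivative_eq_intros)
  then show "q \<in> causal_future A"
    unfolding causal_future_def by (intro CollectI exI[of _ 0] exI[of _ 1] exI[of _ ?\<zeta>]) simp
qed

lemma open_aff_group: "open aff_group"
  unfolding aff_group_def by (intro open_Collect_less continuous_intros)

lemma continuous_w_coord: "continuous_on S (w_coord A)"
  unfolding w_coord_def using lambda_pos by (intro continuous_intros) auto

lemma interior_causal_future:
  "top_of_set aff_group interior_of causal_future A
     = {q \<in> aff_group. \<bar>w_coord A q\<bar> < s * (snd q - 1)}" (is "?I = ?R")
proof
  have "open {q. \<bar>w_coord A q\<bar> < s * (snd q - 1)}"
    by (intro open_Collect_less continuous_intros continuous_w_coord)
  then have "openin (top_of_set aff_group) ?R"
    by (auto simp: openin_open)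
  then show "?R \<subseteq> ?I"
    by (rule interior_of_maximal[rotated]) (auto simp: causal_future_eq)
  show "?I \<subseteq> ?R"
  proof
    fix q assume q: "q \<in> ?I"
    have sub: "?I \<subseteq> causal_future A"
      by (rule interior_of_subset)
    with q have J: "q \<in> causal_future A"
      by (rule subsetD[rotated])
    have "open ?I"
      using openin_interior_of[of "top_of_set aff_group" "causal_future A"]
      by (simp only: openin_open_eq[OF open_aff_group])
    \<comment> \<open>Moving towards the past along a line w = const leaves the cone at once from its boundary.\<close>
    define c where "c \<epsilon> = q + \<epsilon> *\<^sub>R (nu_par A * s, - s)" for \<epsilon> :: real
    have "((\<lambda>\<epsilon>. c \<epsilon>) \<longlongrightarrow> c 0) (at_right 0)"
      unfolding c_def by (intro tendsto_intros)
    moreover have "c 0 = q"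
      by (simp add: c_def prod_eq_iff)
    ultimately have "\<forall>\<^sub>F \<epsilon> in at_right 0. c \<epsilon> \<in> ?I"
      using \<open>open ?I\<close> q by (auto dest: topological_tendstoD)
    moreover have "\<forall>\<^sub>F \<epsilon> in at_right (0::real). 0 < \<epsilon>"
      by (rule eventually_at_right_less)
    ultimately have "\<forall>\<^sub>F \<epsilon> in at_right 0. c \<epsilon> \<in> ?I \<and> 0 < \<epsilon>"
      by (rule eventually_conj)
    then obtain \<epsilon> where \<epsilon>: "c \<epsilon> \<in> ?I" "0 < \<epsilon>"
      using eventually_happens'[OF trivial_limit_at_right_real] by blast
    then have "c \<epsilon> \<in> causal_future A"
      by (intro subsetD[OF sub])
    moreover have "w_coord A (c \<epsilon>) = w_coord A q" "snd (c \<epsilon>) = snd q - s * \<epsilon>"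
      by (simp_all add: c_def w_coord_def algebra_simps)
    ultimately have "\<bar>w_coord A q\<bar> \<le> s * (snd q - 1) - \<epsilon>"
      by (simp add: causal_future_eq algebra_simps)
    with J \<epsilon>(2) show "q \<in> ?R"
      by (simp add: causal_future_eq)
  qed
qed

lemma frontier_causal_future:
  "top_of_set aff_group frontier_of causal_future A
     = {q \<in> aff_group. \<bar>w_coord A q\<bar> = s * (snd q - 1)}"
proof -
  have "closed {q. \<bar>w_coord A q\<bar> \<le> s * (snd q - 1)}"
    by (intro closed_Collect_le continuous_intros continuous_w_coord)
  then have "closedin (top_of_set aff_group) (causal_future A)"
    by (auto simp: closedin_closed causal_future_eq)
  then have "top_of_set aff_group closure_of causal_future A = causal_future A"
    by (rule closure_of_closedin)
  then show ?thesis
    unfolding frontier_of_def interior_causal_future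
    by (intro set_eqI) (simp only: Diff_iff mem_Collect_eq causal_future_eq, metis order_le_less less_irrefl)
qed

section \<open>Distance off the interior of the cone\<close>

lemma length_nonneg:
  assumes "future_curve A t0 t1 \<zeta>"
  shows "0 \<le> lorentz_length A t0 t1 \<zeta>"
  unfolding lorentz_length_def set_lebesgue_integral_def
proof (rule integral_nonneg_AE)
  show "AE t in lebesgue. 0 \<le> indicat_real {t0..t1} t *\<^sub>R
      sqrt (- lorentz_form A (\<zeta> t) (vector_derivative \<zeta> (at t)))"
    using future_curve_velocity[OF assms]
  proof eventually_elim
    case (elim t)
    then have "t \<in> {t0..t1} \<Longrightarrow> 0 \<le> - lorentz_form A (\<zeta> t) (vector_derivative \<zeta> (at t))"
      using s_cases by (subst lorentz_form_eq) (auto intro!: divide_nonneg_nonneg simp: abs_le_square_iff[symmetric])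
    then show ?case
      by (auto simp: indicator_def)
  qed
qed

lemma dist_outside: "q \<notin> causal_future A \<Longrightarrow> lorentz_dist A aff_id q = 0"
  by (auto simp: lorentz_dist_def curve_lengths_def causal_future_def)

text \<open>
  At a point with $|w| = s(y-1)$ the bound given by the potential with momentum $\pm p$, the sign
  being that of $w$, tends to $0$ as $p \to \infty$: the leading terms $p\,s(y-1)$ and $p|w|$ cancel.
\<close>

lemma dist_frontier:
  assumes q: "q \<in> aff_group" "\<bar>w_coord A q\<bar> = s * (snd q - 1)"
  shows "lorentz_dist A aff_id q = 0"
proof -
  have "l = 0" if l: "l \<in> curve_lengths A aff_id q" for l
  proof -
    obtain t0 t1 \<zeta> where \<zeta>: "future_curve A t0 t1 \<zeta>" "\<zeta> t0 = aff_id" "\<zeta> t1 = q"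
      and l: "l = lorentz_length A t0 t1 \<zeta>"
      using l by (auto simp: curve_lengths_def)
    define \<sigma> :: real where "\<sigma> = (if 0 \<le> w_coord A q then 1 else - 1)"
    have \<sigma>: "\<sigma> * w_coord A q = s * (snd q - 1)"
      using q(2) by (auto simp: \<sigma>_def)
    have cal: "calibration (p * \<sigma>) y = calibration p y" for p y
      by (simp add: \<sigma>_def)
    have pot: "potential (p * \<sigma>) q - potential (p * \<sigma>) aff_id
        = (s * (calibration p (snd q) - calibration p 1) - p * (\<sigma> * w_coord A q)) / Delta A" for p
      unfolding potential_def cal by (simp add: diff_divide_distrib[symmetric] algebra_simps)
    have bound: "l \<le> s * (calibration p (snd q) - calibration p 1 - p * (snd q - 1)) / Delta A" for p
    proof -
      have "l \<le> potential (p * \<sigma>) q - potential (p * \<sigma>) aff_id"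
        using length_vs_potential(1)[OF \<zeta>(1), of "p * \<sigma>"] \<zeta>(2,3) l by simp
      also have "\<dots> = s * (calibration p (snd q) - calibration p 1 - p * (snd q - 1)) / Delta A"
        unfolding pot \<sigma> by (simp add: algebra_simps)
      finally show ?thesis .
    qed
    have "((\<lambda>p. s * (calibration p (snd q) - calibration p 1 - p * (snd q - 1)) / Delta A) \<longlongrightarrow> s * 0 / Delta A) at_top"
      using q(1) Delta_pos by (intro tendsto_intros calibration_asymptotics) (auto simp: aff_group_def)
    then have "l \<le> s * 0 / Delta A"
      by (rule tendsto_lowerbound) (use bound in auto)
    with length_nonneg[OF \<zeta>(1)] l show "l = 0" by simp
  qed
  moreover have "q \<in> causal_future A"
    using q by (simp add: causal_future_eq)
  then have "curve_lengths A aff_id q \<noteq> {}"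
    by (auto simp: curve_lengths_def causal_future_def)
  ultimately have "curve_lengths A aff_id q = {0}"
    by blast
  then show ?thesis
    by (simp add: lorentz_dist_def)
qed

lemma interior_if_dist_pos:
  assumes "q \<in> aff_group" "0 < lorentz_dist A aff_id q"
  shows "q \<in> top_of_set aff_group interior_of causal_future A"
proof -
  have "q \<in> causal_future A"
    using assms(2) dist_outside[of q] by force
  moreover have "\<bar>w_coord A q\<bar> \<noteq> s * (snd q - 1)"
    using assms dist_frontier[of q] by force
  ultimately show ?thesis
    unfolding interior_causal_future by (simp add: causal_future_eq)
qed

section \<open>Geodesics and the distance to their endpoints\<close>

text \<open>
  The curve $w = s(\sqrt{1+p^2y^2} - \sqrt{1+p^2})/p$, the geodesic from the identity with momentum
  $p$. The rationalised form covers $p = 0$, where it is the line $w = 0$.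
\<close>

definition geodesic_w :: "real \<Rightarrow> real \<Rightarrow> real" where
  "geodesic_w p y = s * p * (y\<^sup>2 - 1) / (boost p y + boost p 1)"

lemma geodesic_w_times_momentum: "p * geodesic_w p y = s * (boost p y - boost p 1)"
proof -
  have "p\<^sup>2 * (y\<^sup>2 - 1) = (boost p y - boost p 1) * (boost p y + boost p 1)"
    using boost_square[of p y] boost_square[of p 1] by (simp add: algebra_simps power2_eq_square)
  moreover have "p * geodesic_w p y = s * (p\<^sup>2 * (y\<^sup>2 - 1)) / (boost p y + boost p 1)"
    unfolding geodesic_w_def by (simp add: power2_eq_square mult_ac)
  ultimately show ?thesis
    using boost_pos[of p y] boost_pos[of p 1] by simp
qed

lemma geodesic_w_derivative:
  "(geodesic_w p has_real_derivative s * p * y / boost p y) (at y)"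
proof (cases "p = 0")
  case True
  then have "geodesic_w p = (\<lambda>_. 0)"
    by (auto simp: geodesic_w_def)
  with True show ?thesis by simp
next
  case False
  then have "geodesic_w p = (\<lambda>y. s * (boost p y - boost p 1) / p)"
    using geodesic_w_times_momentum[of p] by (auto simp: field_simps)
  then show ?thesis
    using False by (auto intro!: derivative_eq_intros boost_derivative simp: power2_eq_square)
qed

text \<open>
  The geodesic runs along the dual direction of its own potential, so it attains the upper bound
  which that potential gives for all curves with the same endpoints.
\<close>

lemma dist_geodesic_endpoint:
  assumes "0 < y" and "0 \<le> s * (y - 1)"
  shows "lorentz_dist A aff_id (of_chart (geodesic_w p y) y)
    = ereal (s * (ln y - ln (1 + boost p y) + ln (1 + boost p 1)) / Delta A)"
proof -
  define q where "q = of_chart (geodesic_w p y) y"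
  let ?h = "\<lambda>t. 1 + t * (y - 1)"
  let ?\<zeta> = "\<lambda>t. of_chart (geodesic_w p (?h t)) (?h t)"
  let ?W' = "\<lambda>t. s * p * ?h t / boost p (?h t) * (y - 1)"
  have der: "((\<lambda>t. geodesic_w p (?h t)) has_real_derivative ?W' t) (at t)" for t
    by (rule DERIV_chain2[OF geodesic_w_derivative]) (auto intro!: derivative_eq_intros)
  have speed: "\<bar>?W' t\<bar> \<le> s * (y - 1)" for t
  proof -
    have "\<bar>s\<bar> = 1"
      using s_cases by auto
    then have "\<bar>?W' t\<bar> = \<bar>p * ?h t\<bar> / boost p (?h t) * \<bar>y - 1\<bar>"
      using boost_pos[of p "?h t"] by (simp add: abs_mult)
    also have "\<dots> \<le> 1 * \<bar>y - 1\<bar>"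
      using abs_le_boost[of p "?h t"] boost_pos[of p "?h t"] by (intro mult_right_mono) auto
    also have "\<dots> = s * (y - 1)"
      using assms(2) s_cases by auto
    finally show ?thesis .
  qed
  note curve = chart_curve[where W = "\<lambda>t. geodesic_w p (?h t)" and W' = ?W', OF assms(1) der speed]
  have ends: "?\<zeta> 0 = aff_id" "?\<zeta> 1 = q"
    by (simp_all add: q_def geodesic_w_def)
  have "lorentz_length A 0 1 ?\<zeta> = potential p (?\<zeta> 1) - potential p (?\<zeta> 0)"
  proof (rule length_vs_potential(2)[OF curve(1)])
    fix t :: real assume t: "t \<in> {0..1}"
    show "s * (p * snd (?\<zeta> t) * snd (vector_derivative ?\<zeta> (at t)))
        = boost p (snd (?\<zeta> t)) * dw (vector_derivative ?\<zeta> (at t))"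
      unfolding curve(2)[OF t] curve(3)[OF t] using boost_pos[of p "?h t"] by simp
  qed
  then have mem: "potential p q - potential p aff_id \<in> curve_lengths A aff_id q"
    unfolding curve_lengths_def using curve(1) ends by (metis (mono_tags, lifting) mem_Collect_eq)
  have upper: "l \<le> potential p q - potential p aff_id" if l: "l \<in> curve_lengths A aff_id q" for l
  proof -
    obtain t0 t1 \<zeta> where "future_curve A t0 t1 \<zeta>" "\<zeta> t0 = aff_id" "\<zeta> t1 = q"
      and "l = lorentz_length A t0 t1 \<zeta>"
      using l by (auto simp: curve_lengths_def)
    then show ?thesis
      using length_vs_potential(1)[of t0 t1 \<zeta> p] by simp
  qed
  have "lorentz_dist A aff_id q = (SUP l\<in>curve_lengths A aff_id q. ereal l)"
    using mem by (auto simp: lorentz_dist_def)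
  also have "\<dots> = ereal (potential p q - potential p aff_id)"
    using mem upper by (intro antisym SUP_least SUP_upper) auto
  also have "potential p q - potential p aff_id
      = s * (ln y - ln (1 + boost p y) + ln (1 + boost p 1)) / Delta A"
    unfolding potential_def q_def of_chart_simps geodesic_w_times_momentum w_coord_id
    by (simp add: calibration_def diff_divide_distrib[symmetric] algebra_simps)
  finally show ?thesis
    by (simp add: q_def)
qed

lemma dist_vertical:
  assumes "0 < y" and "0 \<le> s * (y - 1)"
  shows "lorentz_dist A aff_id (of_chart 0 y) = ereal (s * (ln y / Delta A))"
  using dist_geodesic_endpoint[OF assms, of 0] by (simp add: geodesic_w_def)

text \<open>
  With momentum $\pm 1/\sinh\rho$ and endpoint height $\sinh\rho/\sinh\tau$ the square roots
  $\sqrt{1+p^2}$ and $\sqrt{1+p^2y^2}$ become $\coth\rho$ and $\coth\tau$. The logarithms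
  $\ln((1+\coth\rho)\sinh\rho) = \rho$ and $\ln((1+\coth\tau)\sinh\tau) = \tau$ then give the length.
\<close>

lemma dist_hyperbolic:
  fixes \<rho> \<tau> \<sigma> :: real
  assumes "0 < \<rho>" "0 < \<tau>" "0 \<le> s * (\<rho> - \<tau>)" "\<sigma> = 1 \<or> \<sigma> = - 1"
  defines "y \<equiv> sinh \<rho> / sinh \<tau>"
  shows "lorentz_dist A aff_id (of_chart (\<sigma> * s * (y * cosh \<tau> - cosh \<rho>)) y)
    = ereal (s * ((\<rho> - \<tau>) / Delta A))"
proof -
  define p where "p = \<sigma> / sinh \<rho>"
  have pos: "0 < sinh \<rho>" "0 < sinh \<tau>"
    using assms by auto
  have y: "0 < y"
    using pos by (simp add: y_def)
  have s_y: "0 \<le> s * (y - 1)"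
    using s_cases assms(3) pos by (auto simp: y_def)
  have \<sigma>: "\<sigma> * \<sigma> = 1" "\<sigma>\<^sup>2 = 1"
    using assms(4) by auto
  have b1: "boost p 1 = cosh \<rho> / sinh \<rho>"
    unfolding boost_def
  proof (rule real_sqrt_unique)
    show "(cosh \<rho> / sinh \<rho>)\<^sup>2 = 1 + p\<^sup>2 * 1\<^sup>2"
      using pos \<sigma> by (simp add: p_def power_divide cosh_square_eq add_divide_distrib)
  qed (use pos in auto)
  have b2: "boost p y = cosh \<tau> / sinh \<tau>"
    unfolding boost_def
  proof (rule real_sqrt_unique)
    show "(cosh \<tau> / sinh \<tau>)\<^sup>2 = 1 + p\<^sup>2 * y\<^sup>2"
      using pos \<sigma> by (simp add: p_def y_def power_divide cosh_square_eq add_divide_distrib)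
  qed (use pos in auto)
  have "\<sigma> = sinh \<rho> * p"
    using pos by (simp add: p_def)
  then have "\<sigma> * geodesic_w p y = sinh \<rho> * (p * geodesic_w p y)"
    by simp
  also have "\<dots> = s * (y * cosh \<tau> - cosh \<rho>)"
    unfolding geodesic_w_times_momentum b1 b2 using pos by (simp add: y_def field_simps)
  finally have "\<sigma> * geodesic_w p y = s * (y * cosh \<tau> - cosh \<rho>)" .
  then have "\<sigma> * \<sigma> * geodesic_w p y = \<sigma> * s * (y * cosh \<tau> - cosh \<rho>)"
    by (metis mult.assoc)
  then have w: "geodesic_w p y = \<sigma> * s * (y * cosh \<tau> - cosh \<rho>)"
    using \<sigma> by simp
  have "1 + boost p 1 = exp \<rho> / sinh \<rho>"
    unfolding b1 using pos by (simp add: sinh_plus_cosh[symmetric] add_divide_distrib)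
  then have l1: "ln (1 + boost p 1) = \<rho> - ln (sinh \<rho>)"
    using pos by (simp add: ln_div)
  have "1 + boost p y = exp \<tau> / sinh \<tau>"
    unfolding b2 using pos by (simp add: sinh_plus_cosh[symmetric] add_divide_distrib)
  then have l2: "ln (1 + boost p y) = \<tau> - ln (sinh \<tau>)"
    using pos by (simp add: ln_div)
  have l3: "ln y = ln (sinh \<rho>) - ln (sinh \<tau>)"
    unfolding y_def using pos by (simp add: ln_div)
  show ?thesis
    using dist_geodesic_endpoint[OF y s_y, of p] unfolding w l1 l2 l3 by simp
qed

text \<open>
  Every interior point with $w \neq 0$ is reached by the parametrisation of the geodesics. The
  arguments of arcosh exceed $1$ by the strict cone inequality, and $\sinh\rho = y\sinh\tau$ is the
  identity $(y^2-1-w^2)^2 - 4w^2 = (y^2-1+w^2)^2 - 4y^2w^2$.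
\<close>

lemma interior_hyperbolic:
  assumes "0 < snd q" "\<bar>w_coord A q\<bar> < s * (snd q - 1)" "w_coord A q \<noteq> 0"
  defines "\<rho> \<equiv> rho A q" and "\<tau> \<equiv> tau A q" and "y \<equiv> snd q" and "w \<equiv> w_coord A q"
  shows "0 < \<rho>" "0 < \<tau>" "0 < s * (\<rho> - \<tau>)"
    and "y = sinh \<rho> / sinh \<tau>" "w = sgn w * s * (y * cosh \<tau> - cosh \<rho>)"
proof -
  have y: "0 < y" and w: "\<bar>w\<bar> < s * (y - 1)" and nz: "w \<noteq> 0"
    using assms by auto
  define r t where "r = s * (y\<^sup>2 - 1 - w\<^sup>2) / (2 * \<bar>w\<bar>)" and "t = s * (y\<^sup>2 - 1 + w\<^sup>2) / (2 * y * \<bar>w\<bar>)"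
  have sign2: "sign2 A q = - s * sgn w"
    using lambda_pos by (simp add: sign2_def w_def sgn_mult)
  have "- s * sgn w * ((1 - y\<^sup>2 + w\<^sup>2) / (2 * w)) = r"
    and "- s * sgn w * ((1 - y\<^sup>2 - w\<^sup>2) / (2 * y * w)) = t"
    using nz y by (cases "0 < w"; simp add: r_def t_def field_simps)+
  then have \<rho>: "\<rho> = arcosh r" and \<tau>: "\<tau> = arcosh t"
    unfolding \<rho>_def \<tau>_def rho_def tau_def sign2 r_def t_def y_def[symmetric] w_def[symmetric]
    by simp_all
  have "2 * \<bar>w\<bar> < s * (y\<^sup>2 - 1 - w\<^sup>2)"
  proof (cases "s = 1")
    case True
    then have "(1 + \<bar>w\<bar>)\<^sup>2 < y\<^sup>2"
      using w by (intro power_strict_mono) auto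
    with True show ?thesis by (simp add: power2_sum)
  next
    case False
    then have "y\<^sup>2 < (1 - \<bar>w\<bar>)\<^sup>2"
      using s_cases w y by (intro power_strict_mono) auto
    with False s_cases show ?thesis by (simp add: power2_diff)
  qed
  then have r: "1 < r"
    using nz by (simp add: r_def)
  have "2 * y * \<bar>w\<bar> < s * (y\<^sup>2 - 1 + w\<^sup>2)"
  proof (cases "s = 1")
    case True
    then have "1\<^sup>2 < (y - \<bar>w\<bar>)\<^sup>2"
      using w by (intro power_strict_mono) auto
    with True show ?thesis by (simp add: power2_diff)
  next
    case False
    then have "(y + \<bar>w\<bar>)\<^sup>2 < 1\<^sup>2"
      using s_cases w y by (intro power_strict_mono) auto
    with False s_cases show ?thesis by (simp add: power2_sum)
  qed
  then have t: "1 < t"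
    using nz y by (simp add: t_def)
  show pos: "0 < \<rho>" "0 < \<tau>"
    using r t by (simp_all add: \<rho> \<tau>)
  have cosh: "cosh \<rho> = r" "cosh \<tau> = t"
    using r t by (simp_all add: \<rho> \<tau> cosh_arcosh_real)
  have r': "2 * \<bar>w\<bar> * r = s * (y\<^sup>2 - 1 - w\<^sup>2)" and t': "2 * \<bar>w\<bar> * (y * t) = s * (y\<^sup>2 - 1 + w\<^sup>2)"
    using nz y by (simp_all add: r_def t_def)
  have "(2 * \<bar>w\<bar>)\<^sup>2 * (r\<^sup>2 - 1) = (2 * \<bar>w\<bar>)\<^sup>2 * (y\<^sup>2 * (t\<^sup>2 - 1))"
  proof -
    have "(2 * \<bar>w\<bar>)\<^sup>2 * (r\<^sup>2 - 1) = (2 * \<bar>w\<bar> * r)\<^sup>2 - 4 * w\<^sup>2"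
      by (simp add: power_mult_distrib algebra_simps)
    also have "\<dots> = (s * s) * (y\<^sup>2 - 1 - w\<^sup>2)\<^sup>2 - 4 * w\<^sup>2"
      unfolding r' by (simp add: power2_eq_square)
    also have "\<dots> = (s * s) * (y\<^sup>2 - 1 + w\<^sup>2)\<^sup>2 - 4 * w\<^sup>2 * y\<^sup>2"
      by (simp add: power2_eq_square algebra_simps)
    also have "\<dots> = (2 * \<bar>w\<bar> * (y * t))\<^sup>2 - 4 * w\<^sup>2 * y\<^sup>2"
      unfolding t' by (simp add: power2_eq_square)
    also have "\<dots> = (2 * \<bar>w\<bar>)\<^sup>2 * (y\<^sup>2 * (t\<^sup>2 - 1))"
      by (simp add: power_mult_distrib algebra_simps)
    finally show ?thesis .
  qed
  then have "r\<^sup>2 - 1 = y\<^sup>2 * (t\<^sup>2 - 1)"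
    using nz by simp
  then have "(sinh \<rho>)\<^sup>2 = (y * sinh \<tau>)\<^sup>2"
    by (simp add: power_mult_distrib sinh_square_eq cosh)
  then have sinh: "sinh \<rho> = y * sinh \<tau>"
    using pos y by (simp add: power2_eq_iff_nonneg)
  then show "y = sinh \<rho> / sinh \<tau>"
    using pos by simp
  have "2 * \<bar>w\<bar> * (y * t) - 2 * \<bar>w\<bar> * r = s * (2 * w\<^sup>2)"
    unfolding r' t' by (simp add: algebra_simps)
  also have "w\<^sup>2 = \<bar>w\<bar> * \<bar>w\<bar>"
    by (simp add: power2_eq_square)
  finally have "2 * \<bar>w\<bar> * (y * t - r) = 2 * \<bar>w\<bar> * (s * \<bar>w\<bar>)"
    by (simp add: algebra_simps)
  then have "y * t - r = s * \<bar>w\<bar>"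
    using nz by simp
  then show "w = sgn w * s * (y * cosh \<tau> - cosh \<rho>)"
    unfolding cosh by (simp add: mult.assoc sgn_mult_abs)
  show "0 < s * (\<rho> - \<tau>)"
  proof (cases "s = 1")
    case True
    then have "sinh \<tau> * 1 < sinh \<tau> * y"
      using w pos by (intro mult_strict_left_mono) auto
    then have "sinh \<tau> < sinh \<rho>"
      using sinh by (simp add: mult.commute)
    with True show ?thesis by simp
  next
    case False
    then have "sinh \<tau> * y < sinh \<tau> * 1"
      using w pos s_cases by (intro mult_strict_left_mono) auto
    then have "sinh \<rho> < sinh \<tau>"
      using sinh by (simp add: mult.commute)
    with False s_cases show ?thesis by auto
  qed
qed

section \<open>Distance on the interior of the cone\<close>

lemma dist_interior_w_nonzero:
  assumes "q \<in> aff_group" "\<bar>w_coord A q\<bar> < s * (snd q - 1)" "w_coord A q \<noteq> 0"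
  shows "lorentz_dist A aff_id q = ereal (s * ((rho A q - tau A q) / Delta A))"
    and "0 < s * ((rho A q - tau A q) / Delta A)"
proof -
  note hyp = interior_hyperbolic[OF _ assms(2,3)]
  have y: "0 < snd q"
    using assms(1) by (simp add: aff_group_def)
  have "sgn (w_coord A q) = 1 \<or> sgn (w_coord A q) = - 1"
    using assms(3) by (simp add: sgn_if)
  from dist_hyperbolic[OF hyp(1)[OF y] hyp(2)[OF y] _ this] hyp(3)[OF y]
  show "lorentz_dist A aff_id q = ereal (s * ((rho A q - tau A q) / Delta A))"
    unfolding hyp(4)[OF y, symmetric] hyp(5)[OF y, symmetric] by simp
  show "0 < s * ((rho A q - tau A q) / Delta A)"
    using hyp(3)[OF y] Delta_pos by simp
qed

lemma dist_interior_w_zero: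
  assumes "q \<in> aff_group" "\<bar>w_coord A q\<bar> < s * (snd q - 1)" "w_coord A q = 0"
  shows "lorentz_dist A aff_id q = ereal (s * (ln (snd q) / Delta A))"
    and "0 < s * (ln (snd q) / Delta A)"
proof -
  have y: "0 < snd q"
    using assms(1) by (simp add: aff_group_def)
  show "lorentz_dist A aff_id q = ereal (s * (ln (snd q) / Delta A))"
    using dist_vertical[OF y] assms(2,3) of_chart_simps(3)[of q] by simp
  show "0 < s * (ln (snd q) / Delta A)"
    using s_cases assms(2,3) y Delta_pos by (auto simp: divide_less_0_iff)
qed

text \<open>
  Any two positive $\rho, \tau$ with $s(\rho-\tau) = l\Delta$ give a point at distance $l$; its
  distance being positive, that point lies in the interior without further calculation.
\<close>

lemma dist_image_w_nonzero:
  "lorentz_dist A aff_id ` (top_of_set aff_group interior_of causal_future A \<inter> {q. w_coord A q \<noteq> 0})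
     = {0<..<\<infinity>}"
proof (intro equalityI subsetI)
  fix x :: ereal assume "x \<in> {0<..<\<infinity>}"
  then obtain l where l: "x = ereal l" "0 < l"
    by (cases x) auto
  define \<rho> \<tau> where "\<rho> = (if s = 1 then 1 + l * Delta A else 1)" and "\<tau> = (if s = 1 then 1 else 1 + l * Delta A)"
  define y where "y = sinh \<rho> / sinh \<tau>"
  define q where "q = of_chart (s * (y * cosh \<tau> - cosh \<rho>)) y"
  have l\<Delta>: "0 < l * Delta A"
    using l(2) Delta_pos by simp
  have pos: "0 < \<rho>" "0 < \<tau>" and diff: "s * (\<rho> - \<tau>) = l * Delta A"
    using l\<Delta> s_cases by (auto simp: \<rho>_def \<tau>_def)
  have "lorentz_dist A aff_id q = ereal (s * ((\<rho> - \<tau>) / Delta A))"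
    unfolding q_def y_def using dist_hyperbolic[OF pos, of 1] diff l\<Delta> by simp
  also have "s * ((\<rho> - \<tau>) / Delta A) = l"
    using diff Delta_pos by (simp add: field_simps)
  finally have d: "lorentz_dist A aff_id q = x"
    by (simp add: l)
  have "y * cosh \<tau> - cosh \<rho> = sinh (\<rho> - \<tau>) / sinh \<tau>"
    using pos by (simp add: y_def sinh_diff field_simps)
  moreover have "\<rho> - \<tau> \<noteq> 0" "s \<noteq> 0"
    using diff l\<Delta> by auto
  ultimately have "w_coord A q \<noteq> 0"
    using pos by (simp add: q_def)
  moreover have "q \<in> aff_group"
    using pos by (simp add: q_def aff_group_def y_def)
  ultimately show "x \<in> lorentz_dist A aff_id ` (top_of_set aff_group interior_of causal_future A \<inter> {q. w_coord A q \<noteq> 0})"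
    using d l interior_if_dist_pos[of q] by (intro image_eqI[of _ _ q]) auto
next
  fix x assume "x \<in> lorentz_dist A aff_id ` (top_of_set aff_group interior_of causal_future A \<inter> {q. w_coord A q \<noteq> 0})"
  then obtain q where q: "q \<in> aff_group" "\<bar>w_coord A q\<bar> < s * (snd q - 1)" "w_coord A q \<noteq> 0"
    and x: "x = lorentz_dist A aff_id q"
    unfolding interior_causal_future by blast
  show "x \<in> {0<..<\<infinity>}"
    unfolding x dist_interior_w_nonzero(1)[OF q] using dist_interior_w_nonzero(2)[OF q] by simp
qed

lemma dist_image_w_zero:
  "lorentz_dist A aff_id ` (top_of_set aff_group interior_of causal_future A \<inter> {q. w_coord A q = 0})
     = {0<..<\<infinity>}"
proof (intro equalityI subsetI)
  fix x :: ereal assume "x \<in> {0<..<\<infinity>}"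
  then obtain l where l: "x = ereal l" "0 < l"
    by (cases x) auto
  define q where "q = of_chart 0 (exp (s * l * Delta A))"
  have "0 \<le> s * (exp (s * l * Delta A) - 1)"
    using s_cases l Delta_pos by auto
  then have "lorentz_dist A aff_id q = ereal (s * (s * l * Delta A / Delta A))"
    unfolding q_def by (subst dist_vertical) auto
  then have d: "lorentz_dist A aff_id q = x"
    using Delta_pos by (simp add: l)
  moreover have "q \<in> aff_group" "w_coord A q = 0"
    by (simp_all add: q_def aff_group_def)
  ultimately show "x \<in> lorentz_dist A aff_id ` (top_of_set aff_group interior_of causal_future A \<inter> {q. w_coord A q = 0})"
    using l interior_if_dist_pos[of q] by (intro image_eqI[of _ _ q]) auto
next
  fix x assume "x \<in> lorentz_dist A aff_id ` (top_of_set aff_group interior_of causal_future A \<inter> {q. w_coord A q = 0})"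
  then obtain q where q: "q \<in> aff_group" "\<bar>w_coord A q\<bar> < s * (snd q - 1)" "w_coord A q = 0"
    and x: "x = lorentz_dist A aff_id q"
    unfolding interior_causal_future by blast
  show "x \<in> {0<..<\<infinity>}"
    unfolding x dist_interior_w_zero(1)[OF q] using dist_interior_w_zero(2)[OF q] by simp
qed

end

theorem theorem15:
  fixes A :: "real ^ 2 ^ 2" and q1 :: "real \<times> real"
  assumes "det A > 0" and "A $ 1 $ 1 \<ge> 0" and "sectional_curvature A > 0"
    and "q1 \<in> aff_group"
  shows
    "let J = causal_future A;
         intJ = (top_of_set aff_group) interior_of J;
         bdJ = (top_of_set aff_group) frontier_of J;
         d = lorentz_dist A aff_id;
         w = w_coord A;
         s1 = sign1 A
     in (q1 \<notin> J \<longrightarrow> d q1 = 0)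
      \<and> (q1 \<in> bdJ \<longrightarrow> d q1 = 0)
      \<and> (q1 \<in> intJ \<inter> {q. w q \<noteq> 0} \<longrightarrow> d q1 = ereal (s1 * ((rho A q1 - tau A q1) / Delta A)))
      \<and> d ` (intJ \<inter> {q. w q \<noteq> 0}) = {0<..<\<infinity>}
      \<and> (q1 \<in> intJ \<inter> {q. w q = 0} \<longrightarrow> d q1 = ereal (s1 * (ln (snd q1) / Delta A)))
      \<and> d ` (intJ \<inter> {q. w q = 0}) = {0<..<\<infinity>}"
proof -
  interpret positive_curvature A
    using assms(1,3) by unfold_locales
  show ?thesis
    unfolding Let_def
  proof (intro conjI impI dist_image_w_nonzero dist_image_w_zero)
    show "lorentz_dist A aff_id q1 = 0" if "q1 \<notin> causal_future A"
      using that by (rule dist_outside)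
    show "lorentz_dist A aff_id q1 = 0" if "q1 \<in> top_of_set aff_group frontier_of causal_future A"
      using that by (simp add: frontier_causal_future dist_frontier)
    show "lorentz_dist A aff_id q1 = ereal (sign1 A * ((rho A q1 - tau A q1) / Delta A))"
      if "q1 \<in> top_of_set aff_group interior_of causal_future A \<inter> {q. w_coord A q \<noteq> 0}"
      using that unfolding interior_causal_future by (intro dist_interior_w_nonzero(1)) auto
    show "lorentz_dist A aff_id q1 = ereal (sign1 A * (ln (snd q1) / Delta A))"
      if "q1 \<in> top_of_set aff_group interior_of causal_future A \<inter> {q. w_coord A q = 0}"
      using that unfolding interior_causal_future by (intro dist_interior_w_zero(1)) auto
  qed
qed

end
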